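(* For every integer $r\geq 3$, we have $g_r([n])= \left(\binom{r}{2}+o(1)\right) 2^{n}$ as $n\to\infty$. Moreover, all but an $o(1)$ proportion (as $n\to\infty$) of the rainbow 3-AP-free $r$-colorings of $[n]$ are 2-colorings, i.e. use at most two of the $r$ colors.
   Context: $[n]=\{1,2,\ldots,n\}$. A 3-term arithmetic progression (3-AP) of $[n]$ is a sequence $a, a+d, a+2d$ of elements of $[n]$ with $d\in[n]$ (so $d\ge 1$). An $r$-coloring of $[n]$ is any map $c\colon [n]\to[r]$ (not necessarily surjective). A 3-AP is rainbow under $c$ if its three terms have pairwise distinct colors; $c$ is rainbow 3-AP-free if no 3-AP of $[n]$ is rainbow. $g_r([n])$ denotes the number of rainbow 3-AP-free $r$-colorings of $[n]$. The asymptotics are for fixed $r$. *)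

theory Defs
  imports Complex_Main "HOL-Library.FuncSet" "HOL-Library.Landau_Symbols"
begin

definition three_APs :: "nat \<Rightarrow> (nat \<times> nat \<times> nat) set" where
  "three_APs n = {(a, a + d, a + 2 * d) | a d.
     d \<in> {1..n} \<and> a \<in> {1..n} \<and> a + d \<in> {1..n} \<and> a + 2 * d \<in> {1..n}}"

text \<open>The extensional function space makes a colouring of \<open>{1..n}\<close> a function whose values
  outside \<open>{1..n}\<close> are fixed, so that cardinalities count maps from \<open>{1..n}\<close> to \<open>{1..r}\<close>.\<close>

definition colorings :: "nat \<Rightarrow> nat \<Rightarrow> (nat \<Rightarrow> nat) set" where
  "colorings r n = {1..n} \<rightarrow>\<^sub>E {1..r}"

definition rainbow :: "(nat \<Rightarrow> nat) \<Rightarrow> nat \<times> nat \<times> nat \<Rightarrow> bool" where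
  "rainbow c = (\<lambda>(x, y, z). c x \<noteq> c y \<and> c y \<noteq> c z \<and> c x \<noteq> c z)"

definition rainbow_free_colorings :: "nat \<Rightarrow> nat \<Rightarrow> (nat \<Rightarrow> nat) set" where
  "rainbow_free_colorings r n = {c \<in> colorings r n. \<forall>p \<in> three_APs n. \<not> rainbow c p}"

definition g :: "nat \<Rightarrow> nat \<Rightarrow> nat" where
  "g r n = card (rainbow_free_colorings r n)"

end

theory Submission
  imports Defs "HOL-Real_Asymp.Real_Asymp"
begin

text \<open>
  Extend a rainbow-free colouring of \<open>{1..n}\<close> to a new point \<open>0\<close>, so that elements of \<open>{1..n}\<close> are
  distances to the new point. The colour of \<open>0\<close> must lie in \<open>{c d, c (2 d)}\<close> whenever
  \<open>c d \<noteq> c (2 d)\<close>. Hence there are at most two choices for it unless \<open>c\<close> is invariant under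
  doubling, in which case \<open>c\<close> is determined by its restriction to \<open>{n div 2 + 1..n}\<close>; this
  recursion bounds the total number of colourings by \<open>O(\<beta>\<^sup>n)\<close> with \<open>\<beta>\<close> slightly above 2.
  If \<open>c\<close> already uses three colours, there is only one choice, unless all pairs
  \<open>{c d, c (2 d)}\<close> with two elements equal the same \<open>{P, Q}\<close>. In this exceptional case the
  positions coloured outside \<open>{P, Q}\<close> are closed under doubling and halving, so one of them,
  \<open>D\<close>, is odd. Given \<open>c\<close> on \<open>{n div 2 + 1..n}\<close>, only the choice between \<open>P\<close> and \<open>Q\<close> remains on
  \<open>{1..n div 2}\<close>, and the progressions with endpoint \<open>D\<close> save a factor exponential in \<open>n\<close>. So
  the number of colourings with at least three colours grows by a factor at most 1 in each step,
  up to an error exponentially smaller than \<open>2\<^sup>n\<close>.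
\<close>

section \<open>Rainbow-free colourings of sets of numbers and their translates\<close>

text \<open>General sets allow restrictions to half-intervals and the extra point \<open>0\<close>.
  The equation \<open>x + z = 2 * y\<close> treats both directions of a progression alike, and its
  constant solutions impose nothing.\<close>

definition rainbow_free_on :: "nat \<Rightarrow> nat set \<Rightarrow> (nat \<Rightarrow> nat) set" where
  "rainbow_free_on r A = {c \<in> A \<rightarrow>\<^sub>E {1..r}.
     \<forall>x\<in>A. \<forall>y\<in>A. \<forall>z\<in>A. x + z = 2 * y \<longrightarrow> c x = c y \<or> c y = c z \<or> c x = c z}"

definition multicolored_on :: "nat \<Rightarrow> nat set \<Rightarrow> (nat \<Rightarrow> nat) set" where
  "multicolored_on r A = {c \<in> rainbow_free_on r A. card (c ` A) > 2}"

text \<open>A solution of \<open>x + z = 2 * y\<close> is a progression with difference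
  \<open>y - x\<close>, the reversal of one, or constant.\<close>

lemma rainbow_free_colorings_eq: "rainbow_free_colorings r n = rainbow_free_on r {1..n}"
proof -
  have "(\<forall>p \<in> three_APs n. \<not> rainbow c p) \<longleftrightarrow>
      (\<forall>x\<in>{1..n}. \<forall>y\<in>{1..n}. \<forall>z\<in>{1..n}. x + z = 2 * y \<longrightarrow> c x = c y \<or> c y = c z \<or> c x = c z)"
    (is "?L \<longleftrightarrow> ?R") for c :: "nat \<Rightarrow> nat"
  proof
    assume L: ?L
    have *: "c x = c y \<or> c y = c z \<or> c x = c z"
      if xyz: "x \<in> {1..n}" "y \<in> {1..n}" "z \<in> {1..n}" "x + z = 2 * y" "x < y" for x y z
    proof -
      have "(x, x + (y - x), x + 2 * (y - x)) \<in> three_APs n"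
        unfolding three_APs_def using xyz by force
      moreover have "x + (y - x) = y" "x + 2 * (y - x) = z"
        using xyz by auto
      ultimately have "\<not> rainbow c (x, y, z)" using L by metis
      then show ?thesis by (simp add: rainbow_def)
    qed
    show ?R
    proof (intro ballI impI)
      fix x y z assume xyz: "x \<in> {1..n}" "y \<in> {1..n}" "z \<in> {1..n}" "x + z = 2 * y"
      consider "x < y" | "x = y" | "z < y" using xyz by linarith
      then show "c x = c y \<or> c y = c z \<or> c x = c z"
        using *[of x y z] *[of z y x] xyz by cases auto
    qed
  next
    assume R: ?R
    show ?L
    proof
      fix p assume "p \<in> three_APs n"
      then obtain a d where p: "p = (a, a + d, a + 2 * d)"
        and *: "a \<in> {1..n}" "a + d \<in> {1..n}" "a + 2 * d \<in> {1..n}"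
        unfolding three_APs_def by blast
      have "a + (a + 2 * d) = 2 * (a + d)" by simp
      then show "\<not> rainbow c p" using R * unfolding p rainbow_def by blast
    qed
  qed
  then show ?thesis
    unfolding rainbow_free_colorings_def rainbow_free_on_def colorings_def by simp
qed

lemma finite_rainbow_free_on: "finite A \<Longrightarrow> finite (rainbow_free_on r A)"
  unfolding rainbow_free_on_def by (rule finite_subset[OF _ finite_PiE[of A "\<lambda>_. {1..r}"]]) auto

lemma finite_multicolored_on: "finite A \<Longrightarrow> finite (multicolored_on r A)"
  unfolding multicolored_on_def using finite_rainbow_free_on by simp

lemma rainbow_free_on_restrict:
  assumes "c \<in> rainbow_free_on r A" "B \<subseteq> A"
  shows "restrict c B \<in> rainbow_free_on r B"
  using assms unfolding rainbow_free_on_def by (auto simp: subset_iff)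

lemma rainbow_free_onD:
  assumes "c \<in> rainbow_free_on r A" "x \<in> A" "y \<in> A" "z \<in> A" "x + z = 2 * y"
  shows "c x = c y \<or> c y = c z \<or> c x = c z"
  using assms unfolding rainbow_free_on_def by blast

lemma rainbow_free_on_range:
  assumes "c \<in> rainbow_free_on r A" "x \<in> A"
  shows "c x \<in> {1..r}"
  using assms unfolding rainbow_free_on_def by (auto simp: PiE_iff)

lemma rainbow_free_on_eqI:
  assumes "c \<in> rainbow_free_on r A" "c' \<in> rainbow_free_on r A" "\<And>x. x \<in> A \<Longrightarrow> c x = c' x"
  shows "c = c'"
  using assms unfolding rainbow_free_on_def by (blast intro: PiE_ext)

text \<open>Translation preserves \<open>x + z = 2 * y\<close>, and \<open>x + a - b\<close> is not
  truncated since \<open>x\<close> is at least \<open>b\<close>.\<close>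

lemma shift_colorings:
  fixes a b m r :: nat
  defines "T \<equiv> \<lambda>c. restrict (\<lambda>x. c (x + a - b)) {b..<b+m} :: nat \<Rightarrow> nat"
  shows "inj_on T (rainbow_free_on r {a..<a+m})"
    and "T ` rainbow_free_on r {a..<a+m} \<subseteq> rainbow_free_on r {b..<b+m}"
    and "T ` multicolored_on r {a..<a+m} \<subseteq> multicolored_on r {b..<b+m}"
proof -
  show "inj_on T (rainbow_free_on r {a..<a+m})"
  proof (rule inj_onI)
    fix c c' assume c: "c \<in> rainbow_free_on r {a..<a+m}" "c' \<in> rainbow_free_on r {a..<a+m}"
      and eq: "T c = T c'"
    show "c = c'"
    proof (rule rainbow_free_on_eqI[OF c])
      fix x assume "x \<in> {a..<a+m}"
      then have "x + b - a \<in> {b..<b+m}" "x + b - a + a - b = x" by auto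
      then show "c x = c' x" using fun_cong[OF eq, of "x + b - a"] by (simp add: T_def)
    qed
  qed
  show rf: "T ` rainbow_free_on r {a..<a+m} \<subseteq> rainbow_free_on r {b..<b+m}"
  proof (rule image_subsetI)
    fix c assume c: "c \<in> rainbow_free_on r {a..<a+m}"
    have "T c \<in> {b..<b+m} \<rightarrow>\<^sub>E {1..r}"
      unfolding T_def restrict_PiE_iff
    proof
      fix x assume "x \<in> {b..<b+m}"
      then have "x + a - b \<in> {a..<a+m}" by auto
      then show "c (x + a - b) \<in> {1..r}" by (rule rainbow_free_on_range[OF c])
    qed
    moreover have "T c x = T c y \<or> T c y = T c z \<or> T c x = T c z"
      if xyz: "x \<in> {b..<b+m}" "y \<in> {b..<b+m}" "z \<in> {b..<b+m}" "x + z = 2 * y" for x y z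
    proof -
      have "x + a - b \<in> {a..<a+m}" "y + a - b \<in> {a..<a+m}" "z + a - b \<in> {a..<a+m}"
        "(x + a - b) + (z + a - b) = 2 * (y + a - b)"
        using xyz by auto
      from rainbow_free_onD[OF c this] show ?thesis using xyz by (simp add: T_def)
    qed
    ultimately show "T c \<in> rainbow_free_on r {b..<b+m}"
      unfolding rainbow_free_on_def by blast
  qed
  show "T ` multicolored_on r {a..<a+m} \<subseteq> multicolored_on r {b..<b+m}"
  proof (rule image_subsetI)
    fix c assume c: "c \<in> multicolored_on r {a..<a+m}"
    have "c ` {a..<a+m} \<subseteq> T c ` {b..<b+m}"
    proof (rule image_subsetI)
      fix x assume "x \<in> {a..<a+m}"
      then have *: "x + b - a \<in> {b..<b+m}" "x + b - a + a - b = x" by auto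
      then have "c x = T c (x + b - a)" by (simp add: T_def)
      then show "c x \<in> T c ` {b..<b+m}" using * by blast
    qed
    then have "card (c ` {a..<a+m}) \<le> card (T c ` {b..<b+m})" by (intro card_mono) auto
    then show "T c \<in> multicolored_on r {b..<b+m}"
      using c rf unfolding multicolored_on_def by auto
  qed
qed

lemma card_rainbow_free_on_shift:
  "card (rainbow_free_on r {a..<a+m}) \<le> card (rainbow_free_on r {b..<b+m})"
  by (rule card_inj_on_le[OF shift_colorings(1,2)]) (simp add: finite_rainbow_free_on)

lemma card_multicolored_on_shift:
  "card (multicolored_on r {a..<a+m}) \<le> card (multicolored_on r {b..<b+m})"
proof -
  have "multicolored_on r {a..<a+m} \<subseteq> rainbow_free_on r {a..<a+m}"
    unfolding multicolored_on_def by blast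
  from card_inj_on_le[OF inj_on_subset[OF shift_colorings(1) this] shift_colorings(3)]
  show ?thesis by (simp add: finite_multicolored_on)
qed

text \<open>Applied with \<open>\<pi>\<close> a restriction map: a bound on the extensions of each
  partial colouring bounds the number of all colourings.\<close>

lemma card_fibres_le:
  assumes "finite X" "\<And>x. x \<in> X \<Longrightarrow> card {c \<in> S. \<pi> c = x} \<le> k"
  shows "card {c \<in> S. \<pi> c \<in> X} \<le> k * card X"
proof -
  have "{c \<in> S. \<pi> c \<in> X} = (\<Union>x\<in>X. {c \<in> S. \<pi> c = x})" by auto
  also have "card \<dots> \<le> (\<Sum>x\<in>X. card {c \<in> S. \<pi> c = x})" by (rule card_UN_le[OF assms(1)])
  also have "\<dots> \<le> (\<Sum>x\<in>X. k)" by (rule sum_mono) (rule assms(2))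
  finally show ?thesis by (simp add: mult.commute)
qed

subsection \<open>Adding a point in front of an interval\<close>

text \<open>A number \<open>d \<in> {1..n}\<close> is viewed as the distance to the new point \<open>0\<close>; the progressions
  through \<open>0\<close> are then the triples \<open>(0, d, 2 d)\<close>.\<close>

definition admissible :: "nat \<Rightarrow> nat \<Rightarrow> (nat \<Rightarrow> nat) \<Rightarrow> nat set" where
  "admissible r n c = {a \<in> {1..r}. \<forall>d. 1 \<le> d \<and> 2 * d \<le> n \<longrightarrow> c d = c (2 * d) \<or> a \<in> {c d, c (2 * d)}}"

text \<open>For these colourings no triple \<open>(0, d, 2 d)\<close> constrains the new point, so
  all \<open>r\<close> colours are admissible there.\<close>

definition doubling_invariant :: "nat \<Rightarrow> nat \<Rightarrow> (nat \<Rightarrow> nat) set" where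
  "doubling_invariant r n = {c \<in> rainbow_free_on r {1..n}.
     \<forall>d. 1 \<le> d \<and> 2 * d \<le> n \<longrightarrow> c d = c (2 * d)}"

text \<open>All jumps, that is, pairs with \<open>c d \<noteq> c (2 * d)\<close>, show the same two
  colours, so combining two jumps does not reduce the choices for the new point to one.
  Doubling-invariant colourings with at least three colours are included.\<close>

definition exceptional :: "nat \<Rightarrow> nat \<Rightarrow> (nat \<Rightarrow> nat) set" where
  "exceptional r n = {c \<in> multicolored_on r {1..n}. \<exists>P\<in>{1..r}. \<exists>Q\<in>{1..r}.
     \<forall>d. 1 \<le> d \<and> 2 * d \<le> n \<longrightarrow> c d = c (2 * d) \<or> {c d, c (2 * d)} = {P, Q}}"

lemma admissible_0:
  assumes "c \<in> rainbow_free_on r {0..n}"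
  shows "c 0 \<in> admissible r n (restrict c {1..n})"
proof -
  have "c d = c (2 * d) \<or> c 0 \<in> {c d, c (2 * d)}" if "1 \<le> d" "2 * d \<le> n" for d
    using rainbow_free_onD[OF assms, of 0 d "2 * d"] that by auto
  moreover have "c 0 \<in> {1..r}" using rainbow_free_on_range[OF assms] by auto
  ultimately show ?thesis unfolding admissible_def by auto
qed

text \<open>A colouring of \<open>{0..n}\<close> is determined by its restriction to
  \<open>{1..n}\<close> and the colour of \<open>0\<close>, which is admissible for that
  restriction.\<close>

lemma card_extensions_le:
  assumes "finite X" "S \<subseteq> rainbow_free_on r {0..n}" "\<And>x. x \<in> X \<Longrightarrow> card (admissible r n x) \<le> k"
  shows "card {c \<in> S. restrict c {1..n} \<in> X} \<le> k * card X"
proof (rule card_fibres_le[OF assms(1)])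
  fix x assume x: "x \<in> X"
  have "card {c \<in> S. restrict c {1..n} = x} \<le> card (admissible r n x)"
  proof (rule card_inj_on_le[of "\<lambda>c. c 0"])
    show "inj_on (\<lambda>c. c 0) {c \<in> S. restrict c {1..n} = x}"
    proof (rule inj_onI)
      fix c c' assume c: "c \<in> {c \<in> S. restrict c {1..n} = x}" "c' \<in> {c \<in> S. restrict c {1..n} = x}"
        and 0: "c 0 = c' 0"
      show "c = c'"
      proof (rule rainbow_free_on_eqI)
        show "c \<in> rainbow_free_on r {0..n}" "c' \<in> rainbow_free_on r {0..n}" using c assms by auto
        fix y assume y: "y \<in> {0..n}"
        have "restrict c {1..n} y = restrict c' {1..n} y" using c by simp
        then show "c y = c' y" using 0 y by (cases "y = 0") (auto simp: restrict_def)
      qed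
    qed
    show "(\<lambda>c. c 0) ` {c \<in> S. restrict c {1..n} = x} \<subseteq> admissible r n x"
      using admissible_0 assms(2) by auto
    show "finite (admissible r n x)" unfolding admissible_def by simp
  qed
  also have "\<dots> \<le> k" by (rule assms(3)[OF x])
  finally show "card {c \<in> S. restrict c {1..n} = x} \<le> k" .
qed

lemma card_admissible_le: "card (admissible r n c) \<le> r"
proof -
  have "card (admissible r n c) \<le> card {1..r}"
    unfolding admissible_def by (rule card_mono) auto
  then show ?thesis by simp
qed

lemma g_eq: "g r n = card (rainbow_free_on r {1..n})"
  unfolding g_def rainbow_free_colorings_eq ..

lemma g_shift: "card (rainbow_free_on r {a+1..a+m}) \<le> g r m"
  using card_rainbow_free_on_shift[of r "a+1" m 1]
  by (simp add: g_eq atLeastLessThanSuc_atLeastAtMost)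

text \<open>Repeated doubling carries every point into the upper half without changing its colour,
  so restriction to the upper half is injective.\<close>

lemma card_doubling_invariant_le: "card (doubling_invariant r n) \<le> g r (n - n div 2)"
proof -
  let ?B = "{n div 2 + 1..n}"
  have "card (doubling_invariant r n) \<le> card (rainbow_free_on r ?B)"
  proof (rule card_inj_on_le[of "\<lambda>c. restrict c ?B"])
    show "inj_on (\<lambda>c. restrict c ?B) (doubling_invariant r n)"
    proof (rule inj_onI)
      fix c c' assume c: "c \<in> doubling_invariant r n" "c' \<in> doubling_invariant r n"
        and eq: "restrict c ?B = restrict c' ?B"
      have *: "c x = c' x" if "x \<in> {1..n}" for x
        using that
      proof (induction "n - x" arbitrary: x rule: less_induct)
        case less
        show ?case
        proof (cases "2 * x \<le> n")
          case True
          then have "c (2 * x) = c' (2 * x)" using less.prems by (intro less.hyps) auto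
          then show ?thesis using c True less.prems unfolding doubling_invariant_def by auto
        next
          case False
          then have "x \<in> ?B" using less.prems by auto
          then show ?thesis using fun_cong[OF eq, of x] by simp
        qed
      qed
      show "c = c'"
        by (rule rainbow_free_on_eqI[of _ r "{1..n}"]) (use c * in \<open>auto simp: doubling_invariant_def\<close>)
    qed
    show "(\<lambda>c. restrict c ?B) ` doubling_invariant r n \<subseteq> rainbow_free_on r ?B"
      unfolding doubling_invariant_def by (auto intro!: rainbow_free_on_restrict)
    show "finite (rainbow_free_on r ?B)" by (simp add: finite_rainbow_free_on)
  qed
  also have "\<dots> \<le> g r (n - n div 2)"
    using g_shift[of r "n div 2" "n - n div 2"] by simp
  finally show ?thesis .
qed

text \<open>Either the restriction to \<open>{1..n}\<close> has a jump, whose two colours are the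
  only candidates for \<open>0\<close>, or it is doubling-invariant.\<close>

lemma g_Suc_le: "g r (Suc n) \<le> 2 * g r n + r * g r (n - n div 2)"
proof -
  let ?S = "rainbow_free_on r {0..n}" and ?I = "doubling_invariant r n"
  let ?X = "rainbow_free_on r {1..n} - ?I"
  have "g r (Suc n) \<le> card ?S"
    using card_rainbow_free_on_shift[of r 1 "Suc n" 0]
    by (simp add: g_eq atLeastLessThanSuc_atLeastAtMost)
  also have "\<dots> \<le> card ({c \<in> ?S. restrict c {1..n} \<in> ?X} \<union> {c \<in> ?S. restrict c {1..n} \<in> ?I})"
    by (rule card_mono) (auto simp: finite_rainbow_free_on intro: rainbow_free_on_restrict)
  also have "\<dots> \<le> card {c \<in> ?S. restrict c {1..n} \<in> ?X} + card {c \<in> ?S. restrict c {1..n} \<in> ?I}"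
    by (rule card_Un_le)
  also have "\<dots> \<le> 2 * card ?X + r * card ?I"
  proof (intro add_mono card_extensions_le[where r = r])
    show "finite ?X" "finite ?I"
      unfolding doubling_invariant_def by (auto simp: finite_rainbow_free_on)
    fix x assume "x \<in> ?X"
    then obtain d where "1 \<le> d" "2 * d \<le> n" "x d \<noteq> x (2 * d)"
      unfolding doubling_invariant_def by auto
    then have "admissible r n x \<subseteq> {x d, x (2 * d)}" unfolding admissible_def by auto
    then have "card (admissible r n x) \<le> card {x d, x (2 * d)}" by (intro card_mono) auto
    also have "\<dots> \<le> 2" by (simp add: card_insert_if)
    finally show "card (admissible r n x) \<le> 2" .
  qed (auto intro: card_admissible_le)
  also have "\<dots> \<le> 2 * g r n + r * g r (n - n div 2)"
    using card_doubling_invariant_le[of r n] card_mono[of "rainbow_free_on r {1..n}" ?X]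
    by (intro add_mono mult_left_mono) (auto simp: g_eq finite_rainbow_free_on)
  finally show ?thesis .
qed

text \<open>The restriction to \<open>{1..n}\<close> is multicoloured and not exceptional (one
  extension), exceptional, or has at most two colours. In the last case \<open>0\<close> carries a
  new colour, which is possible only if the restriction is doubling-invariant.\<close>

lemma card_multicolored_Suc_le:
  assumes "r \<ge> 1"
  shows "card (multicolored_on r {1..Suc n}) \<le> card (multicolored_on r {1..n})
    + r * card (exceptional r n) + r * g r (n - n div 2)"
proof -
  let ?S = "multicolored_on r {0..n}" and ?I = "doubling_invariant r n"
  let ?E = "exceptional r n" and ?X = "multicolored_on r {1..n} - exceptional r n"
  let ?R = "\<lambda>c. restrict c {1..n}"
  have S: "?S \<subseteq> rainbow_free_on r {0..n}" unfolding multicolored_on_def by blast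
  have cover: "?S \<subseteq> {c \<in> ?S. ?R c \<in> ?X} \<union> {c \<in> ?S. ?R c \<in> ?E} \<union> {c \<in> ?S. ?R c \<in> ?I}"
  proof
    fix c assume c: "c \<in> ?S"
    then have c': "c \<in> rainbow_free_on r {0..n}" using S by auto
    then have R: "?R c \<in> rainbow_free_on r {1..n}" by (rule rainbow_free_on_restrict) auto
    have "?R c \<in> ?I" if "?R c \<notin> multicolored_on r {1..n}"
    proof (rule ccontr)
      assume "?R c \<notin> ?I"
      then obtain d where d: "1 \<le> d" "2 * d \<le> n" "c d \<noteq> c (2 * d)"
        using R unfolding doubling_invariant_def by auto
      then have "c 0 \<in> {c d, c (2 * d)}"
        using admissible_0[OF c'] unfolding admissible_def by auto
      then have "c 0 \<in> c ` {1..n}" using d by auto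
      moreover have "{0..n} = insert 0 {1..n}" by auto
      ultimately have "c ` {0..n} = ?R c ` {1..n}" by auto
      then show False using that c R unfolding multicolored_on_def by auto
    qed
    then show "c \<in> {c \<in> ?S. ?R c \<in> ?X} \<union> {c \<in> ?S. ?R c \<in> ?E} \<union> {c \<in> ?S. ?R c \<in> ?I}"
      using c by blast
  qed
  have fin: "finite ?X" "finite ?E" "finite ?I"
    unfolding doubling_invariant_def exceptional_def
    by (auto simp: finite_rainbow_free_on finite_multicolored_on)
  have "card (multicolored_on r {1..Suc n}) \<le> card ?S"
    using card_multicolored_on_shift[of r 1 "Suc n" 0]
    by (simp add: atLeastLessThanSuc_atLeastAtMost)
  also have "\<dots> \<le> card ({c \<in> ?S. ?R c \<in> ?X} \<union> {c \<in> ?S. ?R c \<in> ?E} \<union> {c \<in> ?S. ?R c \<in> ?I})"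
    by (rule card_mono[OF _ cover]) (auto simp: finite_multicolored_on)
  also have "\<dots> \<le> card {c \<in> ?S. ?R c \<in> ?X} + card {c \<in> ?S. ?R c \<in> ?E} + card {c \<in> ?S. ?R c \<in> ?I}"
    by (meson add_mono card_Un_le le_refl order_trans)
  also have "\<dots> \<le> 1 * card ?X + r * card ?E + r * card ?I"
  proof (intro add_mono card_extensions_le[where r = r] fin S)
    fix x assume x: "x \<in> ?X"
    then have x': "x \<in> rainbow_free_on r {1..n}" unfolding multicolored_on_def by auto
    have ne: "\<exists>d. 1 \<le> d \<and> 2 * d \<le> n \<and> x d \<noteq> x (2 * d) \<and> {x d, x (2 * d)} \<noteq> {P, Q}"
      if PQ: "P \<in> {1..r}" "Q \<in> {1..r}" for P Q
    proof (rule ccontr)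
      assume "\<not> ?thesis"
      then have *: "\<forall>d. 1 \<le> d \<and> 2 * d \<le> n \<longrightarrow> x d = x (2 * d) \<or> {x d, x (2 * d)} = {P, Q}"
        by blast
      have "x \<in> exceptional r n"
        unfolding exceptional_def
      proof (rule CollectI, rule conjI)
        show "x \<in> multicolored_on r {1..n}" using x by blast
        show "\<exists>P\<in>{1..r}. \<exists>Q\<in>{1..r}. \<forall>d. 1 \<le> d \<and> 2 * d \<le> n \<longrightarrow>
            x d = x (2 * d) \<or> {x d, x (2 * d)} = {P, Q}"
          by (rule bexI[OF _ PQ(1)], rule bexI[OF _ PQ(2)], rule *)
      qed
      then show False using x by blast
    qed
    \<comment> \<open>The choice \<open>P = Q = 1\<close> yields some jump \<open>d\<close>; taking
      the colours of this jump for \<open>P\<close> and \<open>Q\<close> then yields a jump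
      \<open>e\<close> with a different colour pair.\<close>
    have "1 \<in> {1..r}" using assms by simp
    from ne[OF this this] obtain d where d: "1 \<le> d" "2 * d \<le> n" "x d \<noteq> x (2 * d)" by blast
    have "x d \<in> {1..r}" "x (2 * d) \<in> {1..r}" using rainbow_free_on_range[OF x'] d by auto
    from ne[OF this] obtain e where e: "1 \<le> e" "2 * e \<le> n" "x e \<noteq> x (2 * e)"
      "{x e, x (2 * e)} \<noteq> {x d, x (2 * d)}" by blast
    have sub: "a \<in> {x d, x (2 * d)} \<inter> {x e, x (2 * e)}" if "a \<in> admissible r n x" for a
    proof -
      have "\<forall>i. 1 \<le> i \<and> 2 * i \<le> n \<longrightarrow> x i = x (2 * i) \<or> a \<in> {x i, x (2 * i)}"
        using that unfolding admissible_def by blast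
      then show ?thesis using d(1,2,3) e(1,2,3) by blast
    qed
    \<comment> \<open>Two distinct two-element sets share at most one element.\<close>
    have "a = b" if "a \<in> admissible r n x" "b \<in> admissible r n x" for a b
      using sub[OF that(1)] sub[OF that(2)] d(3) e(3,4) by auto
    moreover have "finite (admissible r n x)" unfolding admissible_def by simp
    ultimately show "card (admissible r n x) \<le> 1" by (simp add: card_le_Suc0_iff_eq)
  qed (rule card_admissible_le)+
  also have "\<dots> \<le> card (multicolored_on r {1..n}) + r * card ?E + r * g r (n - n div 2)"
    using card_doubling_invariant_le[of r n] card_mono[of "multicolored_on r {1..n}" ?X]
    by (intro add_mono mult_left_mono) (auto simp: finite_multicolored_on)
  finally show ?thesis .
qed

subsection \<open>Exceptional colourings\<close>

text \<open>The condition of \<open>exceptional\<close> for one fixed pair. The third colour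
  re-enters later as a position \<open>D\<close> coloured outside \<open>{P, Q}\<close>.\<close>

definition two_colored_jumps :: "nat \<Rightarrow> nat \<Rightarrow> nat \<Rightarrow> nat \<Rightarrow> (nat \<Rightarrow> nat) set" where
  "two_colored_jumps r n P Q = {c \<in> rainbow_free_on r {1..n}.
     \<forall>d. 1 \<le> d \<and> 2 * d \<le> n \<longrightarrow> c d = c (2 * d) \<or> {c d, c (2 * d)} = {P, Q}}"

lemma two_colored_jumps_double:
  assumes "c \<in> two_colored_jumps r n P Q" "1 \<le> d" "2 * d \<le> n"
  shows "c (2 * d) \<in> {P, Q} \<longleftrightarrow> c d \<in> {P, Q}" and "c d \<notin> {P, Q} \<Longrightarrow> c (2 * d) = c d"
proof -
  have "c d = c (2 * d) \<or> {c d, c (2 * d)} = {P, Q}"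
    using assms unfolding two_colored_jumps_def by blast
  then show "c (2 * d) \<in> {P, Q} \<longleftrightarrow> c d \<in> {P, Q}" "c d \<notin> {P, Q} \<Longrightarrow> c (2 * d) = c d"
    by (auto simp: doubleton_eq_iff)
qed

text \<open>Doubling up to the upper half only ever swaps \<open>P\<close> and \<open>Q\<close>.
  Hence the upper half determines which positions are coloured outside \<open>{P, Q}\<close>, and
  their colours.\<close>

lemma two_colored_jumps_agree:
  assumes c: "c \<in> two_colored_jumps r n P Q" and c': "c' \<in> two_colored_jumps r n P Q"
    and eq: "\<And>x. x \<in> {n div 2 + 1..n} \<Longrightarrow> c x = c' x"
    and "x \<in> {1..n}"
  shows "c x = c' x \<or> (c x \<in> {P, Q} \<and> c' x \<in> {P, Q})"
  using \<open>x \<in> {1..n}\<close>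
proof (induction "n - x" arbitrary: x rule: less_induct)
  case less
  show ?case
  proof (cases "2 * x \<le> n")
    case True
    then have x: "1 \<le> x" "2 * x \<le> n" and "2 * x \<in> {1..n}" "n - 2 * x < n - x"
      using less.prems by auto
    then have IH: "c (2 * x) = c' (2 * x) \<or> c (2 * x) \<in> {P, Q} \<and> c' (2 * x) \<in> {P, Q}"
      using less.hyps[of "2 * x"] by blast
    note dbl = two_colored_jumps_double[OF c x] and dbl' = two_colored_jumps_double[OF c' x]
    show ?thesis
    proof (cases "c x \<in> {P, Q}")
      case True
      then have "c' (2 * x) \<in> {P, Q}" using IH dbl(1) by presburger
      then show ?thesis using True dbl'(1) by simp
    next
      case False
      then have notin: "c (2 * x) \<notin> {P, Q}" using dbl(1) by simp
      then have eq2: "c (2 * x) = c' (2 * x)" using IH by presburger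
      then have "c' x \<notin> {P, Q}" using notin dbl'(1) by simp
      then show ?thesis using dbl(2)[OF False] dbl'(2) eq2 by simp
    qed
  next
    case False
    then have "x \<in> {n div 2 + 1..n}" using less.prems by auto
    then show ?thesis using eq by blast
  qed
qed

lemma card_residue_class_ge: "U div 4 \<le> card {u \<in> {1..U}. u mod 4 = k mod (4::nat)}"
proof -
  \<comment> \<open>The representative is taken in \<open>{1..4}\<close>, not \<open>{0..3}\<close>,
    so that \<open>4 * i + j\<close> lies in \<open>{1..U}\<close> for every
    \<open>i < U div 4\<close>.\<close>
  obtain j :: nat where j: "1 \<le> j" "j \<le> 4" "j mod 4 = k mod 4"
  proof (cases "k mod 4 = 0")
    case True
    then show ?thesis using that[of 4] by simp
  next
    case False
    moreover have "k mod 4 < 4" by simp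
    ultimately show ?thesis using that[of "k mod 4"] by simp
  qed
  have "card {..<U div 4} \<le> card {u \<in> {1..U}. u mod 4 = k mod 4}"
  proof (rule card_inj_on_le[of "\<lambda>i. 4 * i + j"])
    show "inj_on (\<lambda>i. 4 * i + j) {..<U div 4}" by (simp add: inj_on_def)
    show "(\<lambda>i. 4 * i + j) ` {..<U div 4} \<subseteq> {u \<in> {1..U}. u mod 4 = k mod 4}"
    proof (rule image_subsetI)
      fix i assume "i \<in> {..<U div 4}"
      then have "i + 1 \<le> U div 4" by simp
      then have "4 * i + j \<le> U" using j by linarith
      moreover have "(4 * i + j) mod 4 = k mod 4" using j(3) by simp
      ultimately show "4 * i + j \<in> {u \<in> {1..U}. u mod 4 = k mod 4}" using j(1) by simp
    qed
  qed simp
  then show ?thesis by simp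
qed

text \<open>For odd \<open>D\<close> the number \<open>2 * D + 2\<close> is divisible by 4.\<close>

lemma four_dvd_add_residue:
  fixes D u :: nat
  assumes "odd D" "u mod 4 = (D + 2) mod 4"
  shows "4 dvd D + u"
proof -
  obtain k where "D = 2 * k + 1" using assms(1) by (rule oddE)
  then have "D + (D + 2) = 4 * (k + 1)" by simp
  moreover have "(D + u) mod 4 = (D + (D + 2)) mod 4" using assms(2) by (metis mod_add_right_eq)
  ultimately show ?thesis by (simp add: mod_eq_0_iff_dvd)
qed

text \<open>Let \<open>D\<close> be an odd position coloured outside \<open>{P, Q}\<close>. If \<open>u \<equiv> D + 2 (mod 4)\<close>, then the
  midpoint \<open>m\<close> of \<open>D\<close> and \<open>u\<close> is even, and if neither \<open>u\<close> nor \<open>m\<close> lies in the set \<open>S\<close> of positions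
  coloured outside \<open>{P, Q}\<close>, then \<open>u\<close> and \<open>m\<close> have the same colour. Only the remaining positions
  of \<open>{1..n div 2} - S\<close> are free.\<close>

lemma card_free_positions_le:
  fixes n D :: nat and S :: "nat set"
  defines "U \<equiv> n div 2"
  assumes S: "\<And>d. 1 \<le> d \<Longrightarrow> 2 * d \<le> n \<Longrightarrow> 2 * d \<in> S \<longleftrightarrow> d \<in> S"
    and D: "odd D" "D \<le> n"
  shows "card {u \<in> {1..U} - S. u mod 4 = (D + 2) mod 4 \<longrightarrow> (D + u) div 2 \<in> S} \<le> U - U div 8"
    (is "card ?F \<le> _")
proof -
  let ?K = "{u \<in> {1..U}. u mod 4 = (D + 2) mod 4}"
  \<comment> \<open>Free positions avoid \<open>S\<close>, so there are at most
    \<open>U - ?s\<close> of them. They also lie in \<open>?A \<union> ?A2\<close>, and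
    \<open>?A2\<close> has at most \<open>?s\<close> elements: if the midpoint \<open>2 * e\<close>
    of \<open>D\<close> and \<open>u\<close> is in \<open>S\<close>, so is
    \<open>e = (D + u) div 4\<close>.\<close>
  let ?A = "{1..U} - ?K" and ?s = "card ({1..U} \<inter> S)"
  let ?A2 = "{u \<in> {1..U}. u mod 4 = (D + 2) mod 4 \<and> (D + u) div 2 \<in> S}"
  have "card ?F \<le> card ({1..U} - S)" by (rule card_mono) auto
  also have "\<dots> = U - ?s" by (subst card_Diff_subset_Int) auto
  finally have 1: "card ?F \<le> U - ?s" .
  have sU: "?s \<le> U" using card_mono[of "{1..U}" "{1..U} \<inter> S"] by simp
  have "card ?A2 \<le> ?s"
  proof (rule card_inj_on_le[of "\<lambda>u. (D + u) div 4"])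
    have quarter: "\<exists>e. D + u = 4 * e \<and> (D + u) div 4 = e \<and> (D + u) div 2 = 2 * e" if "u \<in> ?A2" for u
    proof -
      have "u mod 4 = (D + 2) mod 4" using that by blast
      then have "4 dvd D + u" by (rule four_dvd_add_residue[OF D(1)])
      then obtain e where "D + u = 4 * e" by (rule dvdE)
      then show ?thesis by simp
    qed
    show "inj_on (\<lambda>u. (D + u) div 4) ?A2"
    proof (rule inj_onI)
      fix u v assume uv: "u \<in> ?A2" "v \<in> ?A2" and eq: "(D + u) div 4 = (D + v) div 4"
      obtain e where e: "D + u = 4 * e" "(D + u) div 4 = e" using quarter[OF uv(1)] by blast
      obtain f where f: "D + v = 4 * f" "(D + v) div 4 = f" using quarter[OF uv(2)] by blast
      have "e = f" using eq unfolding e(2) f(2) .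
      then have "D + u = D + v" unfolding e(1) f(1) by (rule arg_cong)
      then show "u = v" by (rule add_left_imp_eq)
    qed
    show "(\<lambda>u. (D + u) div 4) ` ?A2 \<subseteq> {1..U} \<inter> S"
    proof (rule image_subsetI)
      fix u assume u: "u \<in> ?A2"
      then obtain e where e: "D + u = 4 * e" "(D + u) div 4 = e" "(D + u) div 2 = 2 * e"
        using quarter by blast
      have "1 \<le> u" "2 * u \<le> n" using u unfolding U_def by auto
      then have e': "1 \<le> e" "2 * e \<le> n" using e(1) D(2) by linarith+
      have "2 * e \<in> S" using u unfolding e(3)[symmetric] by blast
      then have "e \<in> S" using S[OF e'] by blast
      moreover have "e \<le> U" using e'(2) unfolding U_def by simp
      ultimately show "(D + u) div 4 \<in> {1..U} \<inter> S" unfolding e(2) using e'(1) by simp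
    qed
  qed simp
  moreover have "card ?A = U - card ?K" by (subst card_Diff_subset) auto
  moreover have "card ?F \<le> card (?A \<union> ?A2)" by (rule card_mono) auto
  moreover have "card (?A \<union> ?A2) \<le> card ?A + card ?A2" by (rule card_Un_le)
  moreover have "card ?K \<le> U"
  proof -
    have "card ?K \<le> card {1..U}" by (rule card_mono) auto
    then show ?thesis by simp
  qed
  moreover have "U div 4 \<le> card ?K" by (rule card_residue_class_ge)
  moreover have "2 * (U div 8) \<le> U div 4" by linarith
  \<comment> \<open>The bounds \<open>U - s\<close> and \<open>U - k + s\<close> are added: the
    unknown size \<open>s\<close> cancels, leaving \<open>2 * F \<le> 2 * U - k\<close>.\<close>
  moreover have "F \<le> U - e"
    if "F \<le> U - s" "s \<le> U" "F \<le> W" "W \<le> A + a" "A = U - k" "a \<le> s" "q \<le> k" "2 * e \<le> q" "k \<le> U"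
    for F W A s k a q e :: nat
    using that by linarith
  ultimately show ?thesis using 1 sU by blast
qed

text \<open>All colourings in the fibre share the upper half, the set \<open>S\<close> and the
  colours on \<open>S\<close>. At a position outside these and outside \<open>F\<close>, the
  progression from \<open>D\<close> through the midpoint forces the colour of the midpoint. So the
  values on \<open>F\<close>, each \<open>P\<close> or \<open>Q\<close>, determine the
  colouring.\<close>

lemma card_fibre_le:
  assumes D: "odd D" "1 \<le> D" "D \<le> n"
  shows "card {c \<in> {c \<in> two_colored_jumps r n P Q. c D \<notin> {P, Q}}. restrict c {n div 2 + 1..n} = b}
    \<le> 2 ^ (n div 2 - n div 2 div 8)" (is "card ?X \<le> _")
proof (cases "?X = {}")
  case False
  let ?B = "{n div 2 + 1..n}" and ?U = "n div 2"
  from False obtain c0 where c0: "c0 \<in> ?X" by blast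
  define S where "S = {d \<in> {1..n}. c0 d \<notin> {P, Q}}"
  define F where "F = {u \<in> {1..?U} - S. u mod 4 = (D + 2) mod 4 \<longrightarrow> (D + u) div 2 \<in> S}"
  have agree: "c x = c' x \<or> (c x \<in> {P, Q} \<and> c' x \<in> {P, Q})"
    if "c \<in> ?X" "c' \<in> ?X" "x \<in> {1..n}" for c c' x
  proof (rule two_colored_jumps_agree[of c r n P Q c' x])
    fix y assume "y \<in> ?B"
    moreover have "restrict c ?B = restrict c' ?B" using that by simp
    ultimately show "c y = c' y" by (metis restrict_apply')
  qed (use that in auto)
  have S_iff: "x \<in> S \<longleftrightarrow> c x \<notin> {P, Q}" if "c \<in> ?X" "x \<in> {1..n}" for c x
    using agree[OF that(1) c0 that(2)] that(2) unfolding S_def by auto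
  have cardF: "card F \<le> ?U - ?U div 8"
    unfolding F_def
  proof (rule card_free_positions_le[OF _ D(1,3)])
    fix d assume "1 \<le> d" "2 * d \<le> n"
    then show "2 * d \<in> S \<longleftrightarrow> d \<in> S"
      using two_colored_jumps_double(1)[of c0 r n P Q d] c0 unfolding S_def by auto
  qed
  have F_sub: "F \<subseteq> {1..n}" unfolding F_def by auto
  have "card ?X \<le> card (F \<rightarrow>\<^sub>E {P, Q})"
  proof (rule card_inj_on_le[of "\<lambda>c. restrict c F"])
    show "inj_on (\<lambda>c. restrict c F) ?X"
    proof (rule inj_onI)
      fix c c' assume c: "c \<in> ?X" "c' \<in> ?X" and eqF: "restrict c F = restrict c' F"
      have onF: "c x = c' x" if "x \<in> F" for x using fun_cong[OF eqF, of x] that by simp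
      have "restrict c ?B = restrict c' ?B" using c by simp
      then have onB: "c x = c' x" if "x \<in> ?B" for x using that by (metis restrict_apply')
      have onS: "c x = c' x" if "x \<in> S" for x
      proof -
        have x: "x \<in> {1..n}" using that unfolding S_def by auto
        show ?thesis using agree[OF c x] S_iff[OF c(1) x] that by blast
      qed
      have rf: "c \<in> rainbow_free_on r {1..n}" "c' \<in> rainbow_free_on r {1..n}"
        using c unfolding two_colored_jumps_def by auto
      show "c = c'"
      proof (rule rainbow_free_on_eqI[OF rf])
        fix x assume x: "x \<in> {1..n}"
        consider "x \<in> ?B" | "x \<in> S" | "x \<in> F" | "x \<in> {1..?U}" "x \<notin> S" "x \<notin> F"
          using x by fastforce
        then show "c x = c' x"
        proof cases
          case 4
          let ?m = "(D + x) div 2"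
          have xD: "x mod 4 = (D + 2) mod 4" and mS: "?m \<notin> S" using 4 unfolding F_def by auto
          obtain j where j: "D + x = 4 * j" using four_dvd_add_residue[OF D(1) xD] by (rule dvdE)
          then have 2: "D + x = 2 * ?m" and m_even: "even ?m" by simp_all
          have m: "?m \<in> {1..n}" using x D by auto
          have cm: "c ?m = c' ?m"
          proof (cases "?m \<in> ?B")
            case False
            \<comment> \<open>The midpoint is even and \<open>D + 2\<close> is odd, so the midpoint
              is not itself a forced position and one step suffices.\<close>
            moreover have "?m mod 4 \<noteq> (D + 2) mod 4"
            proof
              assume "?m mod 4 = (D + 2) mod 4"
              moreover have "even (a mod 4) \<longleftrightarrow> even a" for a :: nat by (rule dvd_mod_iff) simp
              ultimately have "even (D + 2)" using m_even by metis
              then show False using D(1) by simp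
            qed
            ultimately have "?m \<in> F" using m mS unfolding F_def by auto
            then show ?thesis by (rule onF)
          qed (rule onB)
          have "c'' x = c'' ?m" if "c'' \<in> ?X" for c''
          proof -
            have "c'' D \<notin> {P, Q}" "c'' x \<in> {P, Q}" "c'' ?m \<in> {P, Q}"
              using that S_iff[OF that m] S_iff[OF that x] mS 4 by blast+
            moreover have "c'' D = c'' ?m \<or> c'' ?m = c'' x \<or> c'' D = c'' x"
            proof (rule rainbow_free_onD[of c'' r "{1..n}" D ?m x])
              show "c'' \<in> rainbow_free_on r {1..n}"
                using that unfolding two_colored_jumps_def by auto
              show "D \<in> {1..n}" using D by simp
            qed (fact m x 2)+
            ultimately show ?thesis by metis
          qed
          from this[OF c(1)] this[OF c(2)] cm show ?thesis by simp
        qed (use onB onS onF in blast)+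
      qed
    qed
    show "(\<lambda>c. restrict c F) ` ?X \<subseteq> F \<rightarrow>\<^sub>E {P, Q}"
    proof (rule image_subsetI)
      fix c assume c: "c \<in> ?X"
      show "restrict c F \<in> F \<rightarrow>\<^sub>E {P, Q}"
        unfolding restrict_PiE_iff
      proof
        fix x assume x: "x \<in> F"
        then have "x \<in> {1..n}" "x \<notin> S" using F_sub unfolding F_def by auto
        then show "c x \<in> {P, Q}" using S_iff[OF c] by blast
      qed
    qed
    show "finite (F \<rightarrow>\<^sub>E {P, Q})"
      by (rule finite_PiE) (auto intro: finite_subset[OF F_sub])
  qed
  also have "\<dots> = card {P, Q} ^ card F"
    using finite_subset[OF F_sub] by (simp add: card_PiE)
  also have "\<dots> \<le> 2 ^ card F" by (rule power_mono) (auto simp: card_insert_if)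
  also have "\<dots> \<le> 2 ^ (?U - ?U div 8)" by (rule power_increasing[OF cardF]) simp
  finally show ?thesis .
next
  case True
  show ?thesis unfolding True by simp
qed

text \<open>A union bound over at most \<open>r * r * n\<close> triples \<open>(P, Q, D)\<close>;
  for each triple, the upper half is chosen first and the fibre over it is bounded.\<close>

lemma card_exceptional_le:
  "card (exceptional r n) \<le> r\<^sup>2 * n * (2 ^ (n div 2 - n div 2 div 8) * g r (n - n div 2))"
proof -
  let ?B = "{n div 2 + 1..n}" and ?N = "2 ^ (n div 2 - n div 2 div 8) * g r (n - n div 2)"
  let ?J = "\<lambda>(P, Q, D). {c \<in> two_colored_jumps r n P Q. c D \<notin> {P, Q}}"
  let ?T = "{1..r} \<times> {1..r} \<times> {D \<in> {1..n}. odd D}"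
  have "exceptional r n \<subseteq> (\<Union>t\<in>?T. ?J t)"
  proof
    fix c assume "c \<in> exceptional r n"
    then obtain P Q where PQ: "P \<in> {1..r}" "Q \<in> {1..r}" and c: "c \<in> two_colored_jumps r n P Q"
      and many: "card (c ` {1..n}) > 2"
      unfolding exceptional_def two_colored_jumps_def multicolored_on_def by blast
    have "\<exists>D. D \<in> {1..n} \<and> c D \<notin> {P, Q}"
    proof (rule ccontr)
      assume "\<not> ?thesis"
      then have "card (c ` {1..n}) \<le> card {P, Q}" by (intro card_mono) auto
      also have "\<dots> \<le> 2" by (simp add: card_insert_if)
      finally show False using many by simp
    qed
    then obtain D where D: "D \<in> {1..n}" "c D \<notin> {P, Q}"
      and min: "\<And>d. d < D \<Longrightarrow> \<not> (d \<in> {1..n} \<and> c d \<notin> {P, Q})"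
      using exists_least_iff[of "\<lambda>D. D \<in> {1..n} \<and> c D \<notin> {P, Q}"] by auto
    \<comment> \<open>\<open>D\<close> is the least position coloured outside \<open>{P, Q}\<close>;
      if it were even, its half would be a smaller one.\<close>
    have "odd D"
    proof
      assume "even D"
      then obtain d where d: "D = 2 * d" by blast
      then show False
        using two_colored_jumps_double(1)[OF c, of d] D min[of d] by auto
    qed
    then have "(P, Q, D) \<in> ?T" using PQ D by blast
    moreover have "c \<in> ?J (P, Q, D)" using c D by simp
    ultimately show "c \<in> (\<Union>t\<in>?T. ?J t)" by blast
  qed
  moreover have fin: "finite (two_colored_jumps r n P Q)" for P Q
    unfolding two_colored_jumps_def by (simp add: finite_rainbow_free_on)
  ultimately have "card (exceptional r n) \<le> card (\<Union>t\<in>?T. ?J t)" by (intro card_mono) auto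
  also have "\<dots> \<le> (\<Sum>t\<in>?T. card (?J t))" by (rule card_UN_le) auto
  also have "\<dots> \<le> (\<Sum>t\<in>?T. ?N)"
  proof (rule sum_mono)
    fix t assume "t \<in> ?T"
    then obtain P Q D where t: "t = (P, Q, D)" and D: "odd D" "1 \<le> D" "D \<le> n" by auto
    let ?Y = "rainbow_free_on r ?B"
    have "card (?J t) \<le> card {c \<in> ?J t. restrict c ?B \<in> ?Y}"
      unfolding t using fin[of P Q]
      by (intro card_mono finite_subset[OF _ fin[of P Q]])
         (auto simp: two_colored_jumps_def intro!: rainbow_free_on_restrict)
    also have "\<dots> \<le> 2 ^ (n div 2 - n div 2 div 8) * card ?Y"
      unfolding t prod.case
      by (rule card_fibres_le[OF _ card_fibre_le[OF D]]) (simp add: finite_rainbow_free_on)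
    also have "\<dots> \<le> ?N"
      using g_shift[of r "n div 2" "n - n div 2"] by (intro mult_left_mono) auto
    finally show "card (?J t) \<le> ?N" .
  qed
  also have "\<dots> = card ?T * ?N" by simp
  also have "card ?T \<le> r\<^sup>2 * n"
  proof -
    have "card {D \<in> {1..n}. odd D} \<le> card {1..n}" by (rule card_mono) auto
    then show ?thesis by (simp add: card_cartesian_product power2_eq_square)
  qed
  finally show ?thesis by simp
qed

subsection \<open>Growth estimates\<close>

text \<open>With a base above 2, the term for the half-length interval is eventually absorbed. The
  exponent 17/16 is small enough for later: 7/16 from the free positions plus 17/32 from the upper
  half is 31/32 < 1.\<close>

lemma g_le_powr: "\<exists>C>0. \<forall>n. real (g r n) \<le> C * 2 powr (17/16 * real n)"
proof -
  let ?b = "\<lambda>x::real. 2 powr (17/16 * x)"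
  have "(2::real) powr 1 < 2 powr (17/16)" by (rule powr_less_mono) auto
  then have b1: "?b 1 - 2 > 0" by simp
  have "(\<lambda>n. real r * ?b ((real n + 1) / 2) / ?b (real n)) \<longlonglongrightarrow> 0" by real_asymp
  then have "\<forall>\<^sub>F n in sequentially. real r * ?b ((real n + 1) / 2) / ?b (real n) < ?b 1 - 2"
    using b1 by (rule order_tendstoD(2))
  then obtain N where N': "\<forall>n\<ge>N. real r * ?b ((real n + 1) / 2) / ?b (real n) < ?b 1 - 2"
    unfolding eventually_sequentially ..
  have N: "2 * ?b (real n) + real r * ?b ((real n + 1) / 2) \<le> ?b (real n + 1)" if "n \<ge> N" for n
  proof -
    have "real r * ?b ((real n + 1) / 2) / ?b (real n) < ?b 1 - 2" using N' that by blast
    then have "real r * ?b ((real n + 1) / 2) < (?b 1 - 2) * ?b (real n)"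
      by (subst (asm) pos_divide_less_eq) simp
    moreover have "?b (real n + 1) = ?b (real n) * ?b 1"
      by (subst powr_add[symmetric]) (simp add: distrib_left)
    ultimately show ?thesis by (simp add: algebra_simps)
  qed
  \<comment> \<open>The sum covers all \<open>n \<le> N\<close>, where the recursive estimate is not
    yet available.\<close>
  define C where "C = 1 + (\<Sum>k\<le>N. real (g r k))"
  have C: "C > 0" unfolding C_def by (intro add_pos_nonneg sum_nonneg) auto
  have "real (g r n) \<le> C * ?b n" for n
  proof (induction n rule: less_induct)
    case (less n)
    show ?case
    proof (cases "n \<le> N")
      case True
      then have "real (g r n) \<le> (\<Sum>k\<le>N. real (g r k))" by (intro member_le_sum) auto
      then have "real (g r n) \<le> C * 1" unfolding C_def by simp
      also have "\<dots> \<le> C * ?b n" using C by (intro mult_left_mono ge_one_powr_ge_zero) auto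
      finally show ?thesis .
    next
      case False
      then obtain k where k: "n = Suc k" "k \<ge> N" by (cases n) auto
      have "real (g r n) \<le> real (2 * g r k + r * g r (k - k div 2))"
        unfolding k(1) by (rule of_nat_mono) (rule g_Suc_le)
      also have "\<dots> = 2 * real (g r k) + real r * real (g r (k - k div 2))" by simp
      also have "\<dots> \<le> 2 * (C * ?b k) + real r * (C * ?b ((real k + 1) / 2))"
      proof (intro add_mono mult_left_mono)
        show "real (g r k) \<le> C * ?b k" using less.IH[of k] k by simp
        have "real (g r (k - k div 2)) \<le> C * ?b (real (k - k div 2))"
          using less.IH[of "k - k div 2"] k by simp
        also have "\<dots> \<le> C * ?b ((real k + 1) / 2)"
        proof (intro mult_left_mono powr_mono)
          have "2 * (k - k div 2) \<le> k + 1" by linarith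
          then have "real (2 * (k - k div 2)) \<le> real (k + 1)" by (rule of_nat_mono)
          then show "real (k - k div 2) \<le> (real k + 1) / 2" by simp
        qed (use C in auto)
        finally show "real (g r (k - k div 2)) \<le> C * ?b ((real k + 1) / 2)" .
      qed auto
      also have "\<dots> = C * (2 * ?b k + real r * ?b ((real k + 1) / 2))" by (simp add: algebra_simps)
      also have "\<dots> \<le> C * ?b (real k + 1)"
        using N[OF k(2)] C by (intro mult_left_mono) (auto simp: add.commute)
      finally show ?thesis unfolding k(1) by (simp add: add.commute)
    qed
  qed
  then show ?thesis using C by blast
qed

text \<open>The one-step errors are summed. Their bound \<open>?G\<close> is increasing, so
  \<open>n\<close> steps cost at most \<open>n\<close> times the last bound.\<close>

lemma card_multicolored_le:
  assumes "r \<ge> 1"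
  shows "\<exists>K. \<forall>n. real (card (multicolored_on r {1..n})) \<le> K * n * (real n + 1) * 2 powr (31/32 * n)"
proof -
  let ?h = "\<lambda>n. real (card (multicolored_on r {1..n}))"
  let ?G = "\<lambda>n::nat. (real n + 1) * 2 powr (31/32 * n)"
  from g_le_powr obtain C where C: "C > 0" "\<And>n. real (g r n) \<le> C * 2 powr (17/16 * real n)" by blast
  define K where "K = 8 * C * r ^ 3"
  have K: "K \<ge> 0" using C(1) unfolding K_def by simp
  have step: "?h (Suc n) \<le> ?h n + K * ?G n" for n
  proof -
    let ?U = "n div 2" and ?m = "n - n div 2"
    let ?e = "?U - ?U div 8"
    \<comment> \<open>Rounding costs at most 1 in this exponent and in the one for
      \<open>g r ?m\<close>, hence the factor 4 further on.\<close>
    have "16 * ?e \<le> 7 * n + 16" by linarith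
    then have "real (16 * ?e) \<le> real (7 * n + 16)" by (rule of_nat_mono)
    then have "real ?e \<le> 7/16 * n + 1" by simp
    then have "2 powr real ?e \<le> 2 powr (7/16 * n + 1)" by (rule powr_mono) simp
    then have 1: "(2::real) ^ ?e \<le> 2 powr (7/16 * n + 1)"
      by (subst powr_realpow[symmetric]) simp_all
    have "17/16 * real ?m \<le> 17/32 * n + 1" by linarith
    then have "C * 2 powr (17/16 * real ?m) \<le> C * 2 powr (17/32 * n + 1)"
      using C(1) by (intro mult_left_mono powr_mono) auto
    with C(2)[of ?m] have 2: "real (g r ?m) \<le> C * 2 powr (17/32 * n + 1)" by linarith
    have "2 ^ ?e * real (g r ?m) \<le> 2 powr (7/16 * n + 1) * (C * 2 powr (17/32 * n + 1))"
      by (intro mult_mono 1 2) auto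
    also have "\<dots> = C * (2 powr (7/16 * n + 1) * 2 powr (17/32 * n + 1))" by (simp add: mult_ac)
    also have "2 powr (7/16 * n + 1) * 2 powr (17/32 * n + 1) = 2 powr (31/32 * n + 2)"
      by (simp add: powr_add[symmetric])
    also have "2 powr (31/32 * n + 2) = 4 * 2 powr (31/32 * n)" by (simp add: powr_add)
    finally have 3: "2 ^ ?e * real (g r ?m) \<le> 4 * C * 2 powr (31/32 * n)" by simp
    \<comment> \<open>The doubling-invariant term is enlarged to the shape of the exceptional one,
      turning \<open>n\<close> into \<open>n + 1\<close>.\<close>
    have "r * card (exceptional r n) + r * g r ?m
        \<le> r * (r\<^sup>2 * n * (2 ^ ?e * g r ?m)) + r ^ 3 * (2 ^ ?e * g r ?m)"
    proof (intro add_mono mult_left_mono mult_mono card_exceptional_le)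
      show "r \<le> r ^ 3" using assms by (simp add: self_le_power)
      show "g r ?m \<le> 2 ^ ?e * g r ?m" by simp
    qed auto
    also have "\<dots> = r ^ 3 * ((n + 1) * (2 ^ ?e * g r ?m))"
      by (simp add: algebra_simps power2_eq_square power3_eq_cube)
    finally have "card (multicolored_on r {1..Suc n})
        \<le> card (multicolored_on r {1..n}) + r ^ 3 * ((n + 1) * (2 ^ ?e * g r ?m))"
      using card_multicolored_Suc_le[OF assms, of n] by linarith
    then have "real (card (multicolored_on r {1..Suc n}))
        \<le> real (card (multicolored_on r {1..n}) + r ^ 3 * ((n + 1) * (2 ^ ?e * g r ?m)))"
      by (rule of_nat_mono)
    also have "\<dots> = ?h n + real r ^ 3 * ((real n + 1) * (2 ^ ?e * real (g r ?m)))"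
      by (simp only: of_nat_add of_nat_mult of_nat_power of_nat_1 of_nat_numeral)
    also have "\<dots> \<le> ?h n + real r ^ 3 * ((real n + 1) * (4 * C * 2 powr (31/32 * n)))"
      using 3 by (intro add_left_mono mult_left_mono) auto
    also have "\<dots> \<le> ?h n + K * ?G n"
      using C(1) by (simp add: K_def mult_ac)
    finally show ?thesis .
  qed
  have "?h n \<le> K * n * ?G n" for n
  proof (induction n)
    case 0
    have "multicolored_on r {} = {}" unfolding multicolored_on_def by simp
    then show ?case by simp
  next
    case (Suc n)
    have "?h (Suc n) \<le> K * n * ?G n + K * ?G n" using step[of n] Suc.IH by linarith
    also have "\<dots> = K * Suc n * ?G n" by (simp add: algebra_simps)
    also have "\<dots> \<le> K * Suc n * ?G (Suc n)"
      using K by (intro mult_left_mono mult_mono powr_mono) auto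
    finally show ?case .
  qed
  then have "?h n \<le> K * n * (real n + 1) * 2 powr (31/32 * n)" for n
    by (simp only: mult.assoc)
  then show ?thesis by blast
qed

lemma multicolored_negligible:
  assumes "r \<ge> 1"
  shows "(\<lambda>n. real (card (multicolored_on r {1..n})) / 2 ^ n) \<longlonglongrightarrow> 0"
proof -
  obtain K where K: "\<And>n. real (card (multicolored_on r {1..n})) \<le> K * n * (real n + 1) * 2 powr (31/32 * n)"
    using card_multicolored_le[OF assms] by blast
  show ?thesis
  proof (rule tendsto_sandwich[of "\<lambda>_. 0"])
    show "\<forall>\<^sub>F n in sequentially. real (card (multicolored_on r {1..n})) / 2 ^ n
        \<le> K * n * (real n + 1) * 2 powr (31/32 * n) / 2 ^ n"
      by (rule always_eventually, rule allI, rule divide_right_mono[OF K]) simp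
    show "(\<lambda>n::nat. K * n * (real n + 1) * 2 powr (31/32 * n) / 2 ^ n) \<longlonglongrightarrow> 0"
      by real_asymp
  qed auto
qed

subsection \<open>Colourings with at most two colours\<close>

definition two_colored :: "nat \<Rightarrow> nat \<Rightarrow> (nat \<Rightarrow> nat) set" where
  "two_colored r n = {c \<in> {1..n} \<rightarrow>\<^sub>E {1..r}. card (c ` {1..n}) \<le> 2}"

text \<open>A rainbow triple already shows three colours, so two-coloured maps can be counted in the
  plain function space.\<close>

lemma two_colored_rainbow_free:
  "two_colored r n = {c \<in> rainbow_free_on r {1..n}. card (c ` {1..n}) \<le> 2}"
proof -
  have "c x = c y \<or> c y = c z \<or> c x = c z"
    if "card (c ` {1..n}) \<le> 2" "x \<in> {1..n}" "y \<in> {1..n}" "z \<in> {1..n}" for c :: "nat \<Rightarrow> nat" and x y z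
  proof (rule ccontr)
    assume "\<not> ?thesis"
    then have "3 = card {c x, c y, c z}" by auto
    also have "\<dots> \<le> card (c ` {1..n})" using that by (intro card_mono) auto
    finally show False using that by simp
  qed
  then show ?thesis unfolding two_colored_def rainbow_free_on_def by blast
qed

lemma g_split: "g r n = card (two_colored r n) + card (multicolored_on r {1..n})"
proof -
  have "rainbow_free_on r {1..n} = two_colored r n \<union> multicolored_on r {1..n}"
    unfolding two_colored_rainbow_free multicolored_on_def by auto
  moreover have "two_colored r n \<inter> multicolored_on r {1..n} = {}"
    unfolding two_colored_rainbow_free multicolored_on_def by auto
  moreover have "finite (two_colored r n)"
    unfolding two_colored_rainbow_free by (simp add: finite_rainbow_free_on)
  ultimately show ?thesis
    by (simp add: g_eq card_Un_disjoint finite_multicolored_on)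
qed

text \<open>Each image extends to a two-element set of colours. Constant colourings are counted
  several times, which is harmless for an upper bound.\<close>

lemma card_two_colored_le:
  assumes "r \<ge> 2"
  shows "card (two_colored r n) \<le> (r choose 2) * 2 ^ n"
proof -
  let ?P = "{S. S \<subseteq> {1..r} \<and> card S = 2}"
  have finP: "finite ?P" by (rule finite_subset[of _ "Pow {1..r}"]) auto
  have finPi: "finite ({1..n} \<rightarrow>\<^sub>E S)" if "S \<in> ?P" for S
    using that by (intro finite_PiE) (auto intro: finite_subset)
  have "two_colored r n \<subseteq> (\<Union>S\<in>?P. {1..n} \<rightarrow>\<^sub>E S)"
  proof
    fix c assume c: "c \<in> two_colored r n"
    then have "c ` {1..n} \<subseteq> {1..r}" "card (c ` {1..n}) \<le> 2"
      unfolding two_colored_def by auto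
    then obtain S where S: "c ` {1..n} \<subseteq> S" "S \<subseteq> {1..r}" "card S = 2"
      using exists_subset_between[of "c ` {1..n}" 2 "{1..r}"] assms by auto
    then have "c \<in> {1..n} \<rightarrow>\<^sub>E S" using c unfolding two_colored_def by (auto simp: PiE_iff)
    then show "c \<in> (\<Union>S\<in>?P. {1..n} \<rightarrow>\<^sub>E S)" using S by blast
  qed
  then have "card (two_colored r n) \<le> card (\<Union>S\<in>?P. {1..n} \<rightarrow>\<^sub>E S)"
    using finP finPi by (intro card_mono finite_UN_I)
  also have "\<dots> \<le> (\<Sum>S\<in>?P. card ({1..n} \<rightarrow>\<^sub>E S))" by (rule card_UN_le[OF finP])
  also have "\<dots> = (\<Sum>S\<in>?P. 2 ^ n)" by (rule sum.cong) (auto simp: card_PiE)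
  also have "\<dots> = (r choose 2) * 2 ^ n" using n_subsets[of "{1..r}" 2] by simp
  finally show ?thesis .
qed

text \<open>A map into a pair that is not onto is constant. The \<open>+ 2\<close> on the right
  avoids truncated subtraction.\<close>

lemma card_onto_pair_ge:
  assumes "card S = 2"
  shows "2 ^ n \<le> card {c \<in> {1..n} \<rightarrow>\<^sub>E S. c ` {1..n} = S} + 2"
proof -
  let ?O = "{c \<in> {1..n} \<rightarrow>\<^sub>E S. c ` {1..n} = S}" and ?k = "\<lambda>a. restrict (\<lambda>_. a) {1..n}"
  have finS: "finite S" using assms by (metis card.infinite zero_neq_numeral)
  have "{1..n} \<rightarrow>\<^sub>E S \<subseteq> ?O \<union> ?k ` S"
  proof
    fix c assume c: "c \<in> {1..n} \<rightarrow>\<^sub>E S"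
    show "c \<in> ?O \<union> ?k ` S"
    proof (cases "c ` {1..n} = S")
      case False
      have "c ` {1..n} \<subseteq> S" using c by auto
      with False obtain s where s: "s \<in> S" "s \<notin> c ` {1..n}" by blast
      then have "card (S - {s}) = 1" using assms by simp
      then obtain t where t: "S - {s} = {t}" by (rule card_1_singletonE)
      have "c x = t" if "x \<in> {1..n}" for x using c that s t by (auto simp: PiE_iff)
      then have "c = ?k t" using c by (intro ext) (auto simp: PiE_iff extensional_def)
      then show ?thesis using t by blast
    qed (use c in simp)
  qed
  moreover have "finite ({1..n} \<rightarrow>\<^sub>E S)" using finS by (simp add: finite_PiE)
  ultimately have "card ({1..n} \<rightarrow>\<^sub>E S) \<le> card (?O \<union> ?k ` S)"
    using finS by (intro card_mono) simp_all
  also have "\<dots> \<le> card ?O + card (?k ` S)" by (rule card_Un_le)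
  also have "\<dots> \<le> card ?O + 2" using card_image_le[OF finS, of ?k] assms by simp
  finally show ?thesis using assms by (simp add: card_PiE)
qed

text \<open>Maps onto different pairs are different, so the counts add up exactly, with a loss of at
  most 2 per pair.\<close>

lemma card_two_colored_ge: "(r choose 2) * 2 ^ n \<le> card (two_colored r n) + 2 * (r choose 2)"
proof -
  let ?P = "{S. S \<subseteq> {1..r} \<and> card S = 2}" and ?O = "\<lambda>S. {c \<in> {1..n} \<rightarrow>\<^sub>E S. c ` {1..n} = S}"
  have finP: "finite ?P" by (rule finite_subset[of _ "Pow {1..r}"]) auto
  have cardP: "card ?P = r choose 2" using n_subsets[of "{1..r}" 2] by simp
  have fin2: "finite (two_colored r n)"
    unfolding two_colored_rainbow_free by (simp add: finite_rainbow_free_on)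
  have sub: "(\<Union>S\<in>?P. ?O S) \<subseteq> two_colored r n"
    unfolding two_colored_def by (auto simp: PiE_iff)
  have "(r choose 2) * 2 ^ n = (\<Sum>S\<in>?P. 2 ^ n)" using cardP by simp
  also have "\<dots> \<le> (\<Sum>S\<in>?P. card (?O S) + 2)" by (rule sum_mono) (rule card_onto_pair_ge, simp)
  also have "\<dots> = (\<Sum>S\<in>?P. card (?O S)) + 2 * (r choose 2)"
    by (simp only: sum.distrib sum_constant cardP mult.commute of_nat_id)
  also have "(\<Sum>S\<in>?P. card (?O S)) = card (\<Union>S\<in>?P. ?O S)"
  proof (rule card_UN_disjoint[symmetric, OF finP])
    show "\<forall>S\<in>?P. finite (?O S)"
    proof
      fix S assume "S \<in> ?P"
      then have "?O S \<subseteq> two_colored r n" using sub by blast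
      then show "finite (?O S)" using fin2 by (rule finite_subset)
    qed
    show "\<forall>S\<in>?P. \<forall>T\<in>?P. S \<noteq> T \<longrightarrow> ?O S \<inter> ?O T = {}" by blast
  qed
  also have "\<dots> \<le> card (two_colored r n)" by (rule card_mono[OF fin2 sub])
  finally show ?thesis by simp
qed

section \<open>Limits of the normalised counts\<close>

theorem corollary1p3:
  fixes r :: nat
  assumes "r \<ge> 3"
  shows "(\<exists>\<epsilon> :: nat \<Rightarrow> real. \<epsilon> \<in> o(\<lambda>_. 1) \<and>
            (\<forall>n. real (g r n) = (real (r choose 2) + \<epsilon> n) * 2 ^ n)) \<and>
         (\<lambda>n. real (card {c \<in> rainbow_free_colorings r n. \<not> card (c ` {1..n}) \<le> 2})
                / real (g r n)) \<in> o(\<lambda>_. 1)"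
proof -
  let ?h = "\<lambda>n. real (card (multicolored_on r {1..n}))" and ?B = "real (r choose 2)"
  let ?a = "\<lambda>n. real (g r n) / 2 ^ n"
  have h0: "(\<lambda>n. ?h n / 2 ^ n) \<longlonglongrightarrow> 0" using assms by (intro multicolored_negligible) simp
  have lower: "?B - 2 * ?B / 2 ^ n \<le> ?a n" for n
  proof -
    have "(r choose 2) * 2 ^ n \<le> g r n + 2 * (r choose 2)"
      using card_two_colored_ge[of r n] g_split[of r n] by linarith
    then have "real ((r choose 2) * 2 ^ n) \<le> real (g r n + 2 * (r choose 2))" by (rule of_nat_mono)
    then have "?B * 2 ^ n - 2 * ?B \<le> real (g r n)" by simp
    then have "(?B * 2 ^ n - 2 * ?B) / 2 ^ n \<le> ?a n" by (rule divide_right_mono) simp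
    then show ?thesis by (simp add: diff_divide_distrib)
  qed
  have upper: "?a n \<le> ?B + ?h n / 2 ^ n" for n
  proof -
    have "g r n \<le> (r choose 2) * 2 ^ n + card (multicolored_on r {1..n})"
      using card_two_colored_le[of r n] g_split[of r n] assms by linarith
    then have "real (g r n) \<le> real ((r choose 2) * 2 ^ n + card (multicolored_on r {1..n}))"
      by (rule of_nat_mono)
    then have "real (g r n) \<le> ?B * 2 ^ n + ?h n" by simp
    then have "?a n \<le> (?B * 2 ^ n + ?h n) / 2 ^ n" by (rule divide_right_mono) simp
    then show ?thesis by (simp add: add_divide_distrib)
  qed
  have a: "?a \<longlonglongrightarrow> ?B"
  proof (rule tendsto_sandwich)
    show "(\<lambda>n::nat. ?B - 2 * ?B / 2 ^ n) \<longlonglongrightarrow> ?B" by real_asymp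
    show "(\<lambda>n. ?B + ?h n / 2 ^ n) \<longlonglongrightarrow> ?B" using tendsto_add[OF tendsto_const h0] by simp
  qed (use lower upper in auto)
  \<comment> \<open>A nonzero limit of \<open>?a\<close> lets the proportion be computed as a
    quotient of limits after dividing both counts by \<open>2 ^ n\<close>.\<close>
  have B: "?B \<noteq> 0" using assms by simp
  have "(\<lambda>n. (?h n / 2 ^ n) / ?a n) \<longlonglongrightarrow> 0"
    using tendsto_divide[OF h0 a B] by simp
  then have ratio: "(\<lambda>n. ?h n / real (g r n)) \<longlonglongrightarrow> 0" by simp
  \<comment> \<open>The witness for \<open>\<epsilon>\<close> is the difference between
    \<open>?a\<close> and its limit.\<close>
  have "(\<lambda>n. ?a n - ?B) \<longlonglongrightarrow> 0" using tendsto_diff[OF a tendsto_const, of ?B] by simp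
  then have "(\<lambda>n. ?a n - ?B) \<in> o(\<lambda>_. 1)" by (intro smalloI_tendsto) auto
  moreover have "\<forall>n. real (g r n) = (?B + (?a n - ?B)) * 2 ^ n" by simp
  moreover have "{c \<in> rainbow_free_colorings r n. \<not> card (c ` {1..n}) \<le> 2} = multicolored_on r {1..n}" for n
    unfolding rainbow_free_colorings_eq multicolored_on_def by auto
  moreover have "(\<lambda>n. ?h n / real (g r n)) \<in> o(\<lambda>_. 1)"
    using ratio by (intro smalloI_tendsto) auto
  ultimately show ?thesis by auto
qed

end
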